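(* Let $\mathcal{V}=(V_i)_{i\in I}$ be a collection of random vectors $V_i\in\mathbb{C}^{2\ell_i+1}$, $\ell_i\in\frac12\mathbb{N}$, defined on a common probability space. Then $\mathcal{V}$ is strongly $D$-invariant if and only if $$(V_i)_{i\in I}\ \overset{\text{law}}{=}\ (D^{\ell_i}(\gamma)V_i)_{i\in I},$$ where $\gamma\in SU(2)$ is a uniformly (Haar) distributed random element independent from $\mathcal{V}$.
   Context: $\frac12\mathbb{N}=\{0,\frac12,1,\dots\}$. For $\ell\in\frac12\mathbb{N}$, coordinates of $\mathbb{C}^{2\ell+1}$ are indexed by $m\in\{-\ell,-\ell+1,\dots,\ell\}$. The Wigner matrix $D^\ell:SU(2)\to U(2\ell+1)$, $D^\ell=(D^\ell_{m,s})_{m,s}$, is the unitary representation defined as follows: with $\psi^\ell_m(z_0,z_1)=\binom{2\ell}{\ell+m}^{1/2}z_0^{\ell+m}z_1^{\ell-m}$ and $g=\begin{pmatrix}\alpha&-\overline\beta\\ \beta&\overline\alpha\end{pmatrix}\in SU(2)$, $\sum_m\psi^\ell_m(z_0,z_1)D^\ell_{m,s}(g)=\psi^\ell_s(\overline\alpha z_0+\overline\beta z_1,-\beta z_0+\alpha z_1)$ for all $z_0,z_1\in\mathbb{C}$. The collection $(V_i)_{i\in I}$ is strongly $D$-invariant if for every $g\in SU(2)$ its joint law equals that of $(D^{\ell_i}(g)V_i)_{i\in I}$. *)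

theory Defs
  imports "HOL-Probability.Probability"
begin

section \<open>The group SU(2)\<close>

definition SU2 :: "(complex ^ 2 ^ 2) set" where
  "SU2 = {A. (\<chi> i j. cnj (A $ j $ i)) ** A = mat 1 \<and> det A = 1}"

lemma SU2_iff:
  "A \<in> SU2 \<longleftrightarrow>
     A $ 1 $ 2 = - cnj (A $ 2 $ 1) \<and> A $ 2 $ 2 = cnj (A $ 1 $ 1) \<and>
     (cmod (A $ 1 $ 1))\<^sup>2 + (cmod (A $ 2 $ 1))\<^sup>2 = 1"
proof -
  define a b c d where abcd: "a = A $ 1 $ 1" "b = A $ 1 $ 2" "c = A $ 2 $ 1" "d = A $ 2 $ 2"
  have *: "A \<in> SU2 \<longleftrightarrow>
      cnj a * a + cnj c * c = 1 \<and> cnj a * b + cnj c * d = 0 \<and>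
      cnj b * a + cnj d * c = 0 \<and> cnj b * b + cnj d * d = 1 \<and> a * d - b * c = 1"
    by (auto simp: SU2_def vec_eq_iff forall_2 matrix_matrix_mult_def sum_2 mat_def det_2 abcd)
  have n: "(cmod a)\<^sup>2 + (cmod c)\<^sup>2 = 1 \<longleftrightarrow> cnj a * a + cnj c * c = 1"
  proof -
    have "cnj a * a + cnj c * c = complex_of_real ((cmod a)\<^sup>2 + (cmod c)\<^sup>2)"
      by (simp only: of_real_add complex_norm_square mult.commute)
    then show ?thesis by (metis of_real_1 of_real_eq_iff)
  qed
  have "b = - cnj c \<and> d = cnj a"
    if "cnj a * a + cnj c * c = 1" "cnj a * b + cnj c * d = 0" "a * d - b * c = 1"
  proof -
    have "d = (cnj a * a + cnj c * c) * d" by (simp add: that(1))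
    also have "\<dots> = cnj a * (a * d - b * c) + c * (cnj a * b + cnj c * d)"
      by (simp add: algebra_simps)
    finally have d: "d = cnj a" by (simp add: that)
    have "b = (cnj a * a + cnj c * c) * b" by (simp add: that(1))
    also have "\<dots> = a * (cnj a * b + cnj c * d) - cnj c * (a * d - b * c)"
      by (simp add: algebra_simps)
    finally have "b = - cnj c" by (simp add: that)
    with d show ?thesis by simp
  qed
  then show ?thesis
    unfolding * abcd[symmetric] n by (auto simp: algebra_simps)
qed

definition SU2_borel :: "(complex ^ 2 ^ 2) measure" where
  "SU2_borel = restrict_space borel SU2"

text \<open>
  On a compact group the normalised Haar measure is the unique left-invariant Borel
  probability measure.
\<close>

definition haar_SU2 :: "(complex ^ 2 ^ 2) measure \<Rightarrow> bool" where
  "haar_SU2 \<mu> \<longleftrightarrow> prob_space \<mu> \<and> sets \<mu> = sets SU2_borel \<and>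
     (\<forall>h\<in>SU2. distr \<mu> SU2_borel (\<lambda>g. h ** g) = \<mu>)"

section \<open>Wigner matrices\<close>

definition half_nats :: "real set" where
  "half_nats = range (\<lambda>n::nat. real n / 2)"

definition windex :: "real \<Rightarrow> real set" where
  "windex l = {m. m \<le> l \<and> (\<exists>k::nat. m = - l + real k)}"

definition wpsi :: "real \<Rightarrow> real \<Rightarrow> complex \<Rightarrow> complex \<Rightarrow> complex" where
  "wpsi l m z0 z1 =
     complex_of_real (sqrt (real (nat \<lfloor>2 * l\<rfloor> choose nat \<lfloor>l + m\<rfloor>)))
       * z0 ^ nat \<lfloor>l + m\<rfloor> * z1 ^ nat \<lfloor>l - m\<rfloor>"

text \<open>
  For g in SU(2) with first column (alpha, beta), the substitution on the right-hand side is
  the action of the inverse of g on the column vector (z0, z1); alpha is \<^term>\<open>g $ 1 $ 1\<close> and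
  beta is \<^term>\<open>g $ 2 $ 1\<close>, see \<open>SU2_iff\<close>.
\<close>

definition wigner_rel :: "real \<Rightarrow> complex ^ 2 ^ 2 \<Rightarrow> (real \<Rightarrow> real \<Rightarrow> complex) \<Rightarrow> bool" where
  "wigner_rel l g D \<longleftrightarrow>
     (\<forall>s\<in>windex l. \<forall>z0 z1.
        (\<Sum>m\<in>windex l. wpsi l m z0 z1 * D m s) =
        wpsi l s (cnj (g $ 1 $ 1) * z0 + cnj (g $ 2 $ 1) * z1)
                 (- (g $ 2 $ 1) * z0 + g $ 1 $ 1 * z1))"

definition wigner :: "real \<Rightarrow> complex ^ 2 ^ 2 \<Rightarrow> real \<Rightarrow> real \<Rightarrow> complex" where
  "wigner l g = (THE D. D \<in> windex l \<rightarrow>\<^sub>E (windex l \<rightarrow>\<^sub>E UNIV) \<and> wigner_rel l g D)"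

subsection \<open>The defining relation determines the matrix\<close>

lemma windex_eq: "windex (real n / 2) = (\<lambda>k. real k - real n / 2) ` {..n}"
  unfolding windex_def by (auto simp: image_iff field_simps)

lemma inj_windex: "inj_on (\<lambda>k. real k - real n / 2) {..n}"
  by (auto simp: inj_on_def)

lemma wpsi_eq:
  assumes "k \<le> n"
  shows "wpsi (real n / 2) (real k - real n / 2) z0 z1 =
           complex_of_real (sqrt (real (n choose k))) * z0 ^ k * z1 ^ (n - k)"
proof -
  have "nat \<lfloor>real n / 2 - (real k - real n / 2)\<rfloor> = n - k"
    using assms by (simp add: of_nat_diff[symmetric] del: of_nat_diff)
  then show ?thesis by (simp add: wpsi_def)
qed

lemma homogeneous_expansion:
  fixes a b c d :: complex
  shows "\<exists>e. \<forall>z0 z1. (a * z0 + b * z1) ^ p * (c * z0 + d * z1) ^ q =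
           (\<Sum>j\<le>p + q. e j * z0 ^ j * z1 ^ (p + q - j))"
proof -
  have step: "\<exists>e'. \<forall>z0 z1. (u * z0 + v * z1) * (\<Sum>j\<le>n. e j * z0 ^ j * z1 ^ (n - j)) =
      (\<Sum>j\<le>Suc n. e' j * z0 ^ j * z1 ^ (Suc n - j))" for u v :: complex and n and e :: "nat \<Rightarrow> complex"
  proof (intro exI allI)
    fix z0 z1 :: complex
    let ?e = "\<lambda>j. (if j = 0 then 0 else u * e (j - 1)) + (if j = Suc n then 0 else v * e j)"
    have 1: "(\<Sum>j\<le>Suc n. (if j = 0 then 0 else u * e (j - 1)) * z0 ^ j * z1 ^ (Suc n - j)) =
        u * z0 * (\<Sum>j\<le>n. e j * z0 ^ j * z1 ^ (n - j))"
      by (subst sum.atMost_Suc_shift) (simp add: sum_distrib_left mult_ac)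
    have 2: "(\<Sum>j\<le>Suc n. (if j = Suc n then 0 else v * e j) * z0 ^ j * z1 ^ (Suc n - j)) =
        v * z1 * (\<Sum>j\<le>n. e j * z0 ^ j * z1 ^ (n - j))"
      by (simp add: sum_distrib_left Suc_diff_le mult_ac)
    show "(u * z0 + v * z1) * (\<Sum>j\<le>n. e j * z0 ^ j * z1 ^ (n - j)) =
        (\<Sum>j\<le>Suc n. ?e j * z0 ^ j * z1 ^ (Suc n - j))"
      using 1 2 by (simp only: distrib_right sum.distrib)
  qed
  show ?thesis
  proof (induction p)
    case 0
    show ?case
    proof (induction q)
      case 0
      show ?case by (rule exI[of _ "\<lambda>_. 1"]) simp
    next
      case (Suc q)
      then obtain e where e: "\<And>z0 z1. (c * z0 + d * z1) ^ q = (\<Sum>j\<le>q. e j * z0 ^ j * z1 ^ (q - j))"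
        by auto
      show ?case using step[where u = c and v = d and n = q and e = e] by (simp only: e add_0 power_0 power_Suc mult_1)
    qed
  next
    case (Suc p)
    then obtain e where e: "\<And>z0 z1. (a * z0 + b * z1) ^ p * (c * z0 + d * z1) ^ q =
        (\<Sum>j\<le>p + q. e j * z0 ^ j * z1 ^ (p + q - j))"
      by auto
    show ?case using step[where u = a and v = b and n = "p + q" and e = e] by (simp only: e add_Suc power_Suc mult.assoc)
  qed
qed

lemma ex1_wigner:
  assumes "l \<in> half_nats"
  shows "\<exists>!D. D \<in> windex l \<rightarrow>\<^sub>E (windex l \<rightarrow>\<^sub>E UNIV) \<and> wigner_rel l g D"
proof -
  obtain n where l: "l = real n / 2" using assms by (auto simp: half_nats_def)
  let ?i = "\<lambda>k. real k - real n / 2"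
  let ?c = "\<lambda>k. complex_of_real (sqrt (real (n choose k)))"
  have c0: "?c k \<noteq> 0" if "k \<le> n" for k using that by simp
  have sum_eq: "(\<Sum>m\<in>windex l. wpsi l m z0 z1 * f m) =
      (\<Sum>k\<le>n. ?c k * f (?i k) * z0 ^ k * z1 ^ (n - k))" for f z0 z1
    unfolding l windex_eq by (subst sum.reindex[OF inj_windex]) (simp add: wpsi_eq mult_ac)
  let ?r = "\<lambda>s z0 z1. wpsi l s (cnj (g $ 1 $ 1) * z0 + cnj (g $ 2 $ 1) * z1)
                 (- (g $ 2 $ 1) * z0 + g $ 1 $ 1 * z1)"
  have "\<exists>f. \<forall>z0 z1. (\<Sum>m\<in>windex l. wpsi l m z0 z1 * f m) = ?r s z0 z1" if s: "s \<in> windex l" for s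
  proof -
    obtain p where p: "p \<le> n" "s = ?i p" using s by (auto simp: l windex_eq)
    obtain e where e: "\<And>z0 z1. (cnj (g $ 1 $ 1) * z0 + cnj (g $ 2 $ 1) * z1) ^ p *
        (- (g $ 2 $ 1) * z0 + g $ 1 $ 1 * z1) ^ (n - p) = (\<Sum>j\<le>n. e j * z0 ^ j * z1 ^ (n - j))"
      using homogeneous_expansion[of "cnj (g $ 1 $ 1)" "cnj (g $ 2 $ 1)" p "- (g $ 2 $ 1)" "g $ 1 $ 1" "n - p"] p
      by auto
    let ?f = "\<lambda>m. ?c p * e (nat \<lfloor>m + real n / 2\<rfloor>) / ?c (nat \<lfloor>m + real n / 2\<rfloor>)"
    show ?thesis
    proof (intro exI allI)
      fix z0 z1
      have "?r s z0 z1 = ?c p * (\<Sum>j\<le>n. e j * z0 ^ j * z1 ^ (n - j))"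
        unfolding e[symmetric] p(2) unfolding l using p(1) by (simp add: wpsi_eq mult.assoc)
      also have "\<dots> = (\<Sum>m\<in>windex l. wpsi l m z0 z1 * ?f m)"
        unfolding sum_eq sum_distrib_left by (rule sum.cong) (use c0 in \<open>auto simp: mult_ac\<close>)
      finally show "(\<Sum>m\<in>windex l. wpsi l m z0 z1 * ?f m) = ?r s z0 z1" ..
    qed
  qed
  then have "\<forall>s\<in>windex l. \<exists>f. \<forall>z0 z1. (\<Sum>m\<in>windex l. wpsi l m z0 z1 * f m) = ?r s z0 z1"
    by blast
  from bchoice[OF this] obtain F where F: "\<And>s z0 z1. s \<in> windex l \<Longrightarrow>
      (\<Sum>m\<in>windex l. wpsi l m z0 z1 * F s m) = ?r s z0 z1"
    by blast
  have W: "wigner_rel l g D \<longleftrightarrow> (\<forall>s\<in>windex l. \<forall>z0 z1.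
      (\<Sum>m\<in>windex l. wpsi l m z0 z1 * D m s) = (\<Sum>m\<in>windex l. wpsi l m z0 z1 * F s m))" for D
    unfolding wigner_rel_def by (simp only: F cong: ball_cong)
  show ?thesis
  proof (rule ex1I)
    show "(\<lambda>m\<in>windex l. \<lambda>s\<in>windex l. F s m) \<in> windex l \<rightarrow>\<^sub>E (windex l \<rightarrow>\<^sub>E UNIV) \<and>
        wigner_rel l g (\<lambda>m\<in>windex l. \<lambda>s\<in>windex l. F s m)"
      by (auto simp: W intro!: sum.cong)
  next
    fix D assume D: "D \<in> windex l \<rightarrow>\<^sub>E (windex l \<rightarrow>\<^sub>E UNIV) \<and> wigner_rel l g D"
    have eq: "D m s = F s m" if ms: "m \<in> windex l" "s \<in> windex l" for m s
    proof -
      have "\<forall>z. (\<Sum>k\<le>n. (?c k * D (?i k) s) * z ^ k) = (\<Sum>k\<le>n. (?c k * F s (?i k)) * z ^ k)"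
      proof
        fix z
        have "(\<Sum>m\<in>windex l. wpsi l m z 1 * D m s) = (\<Sum>m\<in>windex l. wpsi l m z 1 * F s m)"
          using D ms by (simp add: W)
        then show "(\<Sum>k\<le>n. (?c k * D (?i k) s) * z ^ k) = (\<Sum>k\<le>n. (?c k * F s (?i k)) * z ^ k)"
          unfolding sum_eq by simp
      qed
      then have "\<forall>k\<le>n. ?c k * D (?i k) s = ?c k * F s (?i k)"
        by (simp only: polyfun_eq_coeffs)
      then show ?thesis using ms c0 by (auto simp: l windex_eq)
    qed
    show "D = (\<lambda>m\<in>windex l. \<lambda>s\<in>windex l. F s m)"
    proof (rule PiE_ext)
      show "D \<in> windex l \<rightarrow>\<^sub>E (windex l \<rightarrow>\<^sub>E UNIV)" using D by simp
      show "(\<lambda>m\<in>windex l. \<lambda>s\<in>windex l. F s m) \<in> windex l \<rightarrow>\<^sub>E (windex l \<rightarrow>\<^sub>E UNIV)" by auto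
      fix m assume m: "m \<in> windex l"
      then have "D m \<in> windex l \<rightarrow>\<^sub>E UNIV" using D by auto
      then show "D m = (\<lambda>m\<in>windex l. \<lambda>s\<in>windex l. F s m) m"
        using m eq[OF m] by (intro PiE_ext[of _ "windex l" "\<lambda>_. UNIV"]) auto
    qed
  qed
qed

lemma wigner_rel_wigner: "l \<in> half_nats \<Longrightarrow> wigner_rel l g (wigner l g)"
  unfolding wigner_def using theI'[OF ex1_wigner] by blast

section \<open>Random vectors and strong invariance\<close>

text \<open>
  A vector in the space of dimension 2l+1 is a function on \<^term>\<open>windex l\<close>, extended by
  \<^const>\<open>undefined\<close> outside of it.
\<close>

definition wspace :: "real \<Rightarrow> (real \<Rightarrow> complex) measure" where
  "wspace l = PiM (windex l) (\<lambda>_. borel)"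

definition wigner_act :: "real \<Rightarrow> complex ^ 2 ^ 2 \<Rightarrow> (real \<Rightarrow> complex) \<Rightarrow> (real \<Rightarrow> complex)" where
  "wigner_act l g v = (\<lambda>m\<in>windex l. \<Sum>s\<in>windex l. wigner l g m s * v s)"

definition family_space :: "'i set \<Rightarrow> ('i \<Rightarrow> real) \<Rightarrow> ('i \<Rightarrow> real \<Rightarrow> complex) measure" where
  "family_space I l = PiM I (\<lambda>i. wspace (l i))"

definition joint_law ::
  "'a measure \<Rightarrow> 'i set \<Rightarrow> ('i \<Rightarrow> real) \<Rightarrow> ('i \<Rightarrow> 'a \<Rightarrow> real \<Rightarrow> complex)
     \<Rightarrow> ('i \<Rightarrow> real \<Rightarrow> complex) measure" where
  "joint_law M I l V = distr M (family_space I l) (\<lambda>\<omega>. \<lambda>i\<in>I. V i \<omega>)"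

definition strongly_D_invariant ::
  "'a measure \<Rightarrow> 'i set \<Rightarrow> ('i \<Rightarrow> real) \<Rightarrow> ('i \<Rightarrow> 'a \<Rightarrow> real \<Rightarrow> complex) \<Rightarrow> bool" where
  "strongly_D_invariant M I l V \<longleftrightarrow>
     (\<forall>g\<in>SU2. joint_law M I l V = joint_law M I l (\<lambda>i \<omega>. wigner_act (l i) g (V i \<omega>)))"

text \<open>
  The library's \<open>indep_var\<close> forces both random variables to have the same value type; this is
  the same notion for two types.
\<close>

definition independent_rv ::
  "'a measure \<Rightarrow> 'b measure \<Rightarrow> ('a \<Rightarrow> 'b) \<Rightarrow> 'c measure \<Rightarrow> ('a \<Rightarrow> 'c) \<Rightarrow> bool" where
  "independent_rv M S X T Y \<longleftrightarrow> X \<in> measurable M S \<and> Y \<in> measurable M T \<and>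
     prob_space.indep_set M {X -` A \<inter> space M |A. A \<in> sets S} {Y -` B \<inter> space M |B. B \<in> sets T}"

end

theory Submission
  imports Defs
begin

text \<open>
  By independence, the randomly rotated family has as law the image of \<open>\<eta> \<Otimes>\<^sub>M \<mu>\<close> under the
  action, with \<open>\<eta>\<close> the Haar measure and \<open>\<mu>\<close> the law of the family. If \<open>\<mu>\<close> is invariant under every \<open>g\<close>,
  Fubini shows that this law is \<open>\<mu>\<close>. Conversely this law is always invariant, since acting by \<open>h\<close>
  replaces the Haar element \<open>g\<close> by \<open>h g\<close>.
\<close>

section \<open>The Wigner representation\<close>

text \<open>\<open>wigner_rel\<close> constrains only the entries indexed by
  \<open>windex l\<close>, whereas \<open>wigner\<close> is the unique extensional solution.
  Replacing \<open>D\<close> by its restriction keeps the relation and makes uniqueness applicable,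
  so later proofs may use candidates that are arbitrary outside the index set.\<close>

lemma wigner_rel_unique:
  assumes "l \<in> half_nats" "wigner_rel l g D" "m \<in> windex l" "s \<in> windex l"
  shows "wigner l g m s = D m s"
proof -
  let ?D = "\<lambda>m\<in>windex l. \<lambda>s\<in>windex l. D m s"
  have "wigner_rel l g ?D"
    using assms(2) by (simp add: wigner_rel_def)
  then have "wigner l g = ?D"
    unfolding wigner_def
    by (intro the1_equality[OF ex1_wigner[OF assms(1)]]) auto
  then show ?thesis using assms by simp
qed

text \<open>The defining relation attaches to each matrix a linear substitution in
  \<open>z0\<close>, \<open>z1\<close>. Performing the one for \<open>g\<close> and inserting the
  result into the one for \<open>h\<close> gives the one for \<open>g ** h\<close>, so the matrix
  product satisfies the relation that characterises \<open>wigner l (g ** h)\<close>.\<close>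

lemma wigner_mult:
  assumes l: "l \<in> half_nats" and g: "g \<in> SU2" and ms: "m \<in> windex l" "s \<in> windex l"
  shows "wigner l (g ** h) m s = (\<Sum>k\<in>windex l. wigner l g m k * wigner l h k s)"
proof (rule wigner_rel_unique[OF l _ ms])
  note rel = wigner_rel_wigner[OF l, unfolded wigner_rel_def, rule_format]
  show "wigner_rel l (g ** h) (\<lambda>m s. \<Sum>k\<in>windex l. wigner l g m k * wigner l h k s)"
    unfolding wigner_rel_def
  proof (intro ballI allI)
    fix s z0 z1 assume s: "s \<in> windex l"
    let ?u = "cnj (g $ 1 $ 1) * z0 + cnj (g $ 2 $ 1) * z1"
    let ?v = "- (g $ 2 $ 1) * z0 + g $ 1 $ 1 * z1"
    have "(\<Sum>m\<in>windex l. wpsi l m z0 z1 * (\<Sum>k\<in>windex l. wigner l g m k * wigner l h k s)) =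
        (\<Sum>k\<in>windex l. (\<Sum>m\<in>windex l. wpsi l m z0 z1 * wigner l g m k) * wigner l h k s)"
      by (simp add: sum_distrib_left sum_distrib_right mult.assoc) (rule sum.swap)
    also have "\<dots> = (\<Sum>k\<in>windex l. wpsi l k ?u ?v * wigner l h k s)"
      by (rule sum.cong) (simp_all only: rel)
    also have "\<dots> = wpsi l s (cnj (h $ 1 $ 1) * ?u + cnj (h $ 2 $ 1) * ?v)
        (- (h $ 2 $ 1) * ?u + h $ 1 $ 1 * ?v)"
      by (rule rel[OF s])
    \<comment> \<open>The first column of \<open>g ** h\<close> involves the second column of
      \<open>g\<close>; membership in \<open>SU2\<close> expresses that column through the first
      one, and the substitution mentions only first columns.\<close>
    also have "cnj (h $ 1 $ 1) * ?u + cnj (h $ 2 $ 1) * ?v =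
        cnj ((g ** h) $ 1 $ 1) * z0 + cnj ((g ** h) $ 2 $ 1) * z1"
      using g by (simp add: SU2_iff matrix_matrix_mult_def sum_2 algebra_simps)
    also have "- (h $ 2 $ 1) * ?u + h $ 1 $ 1 * ?v =
        - ((g ** h) $ 2 $ 1) * z0 + (g ** h) $ 1 $ 1 * z1"
      using g by (simp add: SU2_iff matrix_matrix_mult_def sum_2 algebra_simps)
    finally show "(\<Sum>m\<in>windex l. wpsi l m z0 z1 * (\<Sum>k\<in>windex l. wigner l g m k * wigner l h k s)) =
        wpsi l s (cnj ((g ** h) $ 1 $ 1) * z0 + cnj ((g ** h) $ 2 $ 1) * z1)
          (- ((g ** h) $ 2 $ 1) * z0 + (g ** h) $ 1 $ 1 * z1)" .
  qed
qed

lemma wigner_act_mult: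
  assumes "l \<in> half_nats" "g \<in> SU2"
  shows "wigner_act l (g ** h) v = wigner_act l g (wigner_act l h v)"
proof -
  have "(\<Sum>s\<in>windex l. wigner l (g ** h) m s * v s) =
      (\<Sum>k\<in>windex l. wigner l g m k * (\<Sum>s\<in>windex l. wigner l h k s * v s))"
    if m: "m \<in> windex l" for m
  proof -
    have "(\<Sum>s\<in>windex l. wigner l (g ** h) m s * v s) =
        (\<Sum>s\<in>windex l. \<Sum>k\<in>windex l. wigner l g m k * (wigner l h k s * v s))"
      using m by (intro sum.cong) (auto simp: wigner_mult[OF assms] sum_distrib_right mult.assoc)
    also have "\<dots> = (\<Sum>k\<in>windex l. \<Sum>s\<in>windex l. wigner l g m k * (wigner l h k s * v s))"
      by (rule sum.swap)
    finally show ?thesis by (simp add: sum_distrib_left)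
  qed
  then show ?thesis by (auto simp: wigner_act_def)
qed

section \<open>Measurability\<close>

lemma SU2_mult:
  assumes "g \<in> SU2" "h \<in> SU2"
  shows "g ** h \<in> SU2"
proof -
  let ?a = "\<lambda>A :: complex ^ 2 ^ 2. \<chi> i j. cnj (A $ j $ i)"
  have "?a (g ** h) = ?a h ** ?a g"
    by (simp add: vec_eq_iff matrix_matrix_mult_def mult.commute)
  then have "?a (g ** h) ** (g ** h) = ?a h ** (?a g ** g) ** h"
    by (simp add: matrix_mul_assoc)
  then show ?thesis using assms by (simp add: SU2_def det_mul)
qed

lemma space_SU2_borel [simp]: "space SU2_borel = SU2"
  by (simp add: SU2_borel_def space_restrict_space)

lemma measurable_SU2_nth [measurable]: "(\<lambda>g. g $ i $ j) \<in> borel_measurable SU2_borel"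
  unfolding SU2_borel_def
  by (intro measurable_restrict_space1 borel_measurable_continuous_onI continuous_intros)

lemma measurable_SU2_cnj_nth [measurable]: "(\<lambda>g. cnj (g $ i $ j)) \<in> borel_measurable SU2_borel"
  unfolding SU2_borel_def
  by (intro measurable_restrict_space1 borel_measurable_continuous_onI continuous_intros)

lemma measurable_SU2_mult:
  assumes "h \<in> SU2"
  shows "(\<lambda>g. h ** g) \<in> measurable SU2_borel SU2_borel"
proof -
  have "continuous_on UNIV (\<lambda>g. h ** g)"
    unfolding matrix_matrix_mult_def by (intro continuous_intros)
  then have "(\<lambda>g. h ** g) \<in> borel_measurable SU2_borel"
    unfolding SU2_borel_def
    by (intro measurable_restrict_space1 borel_measurable_continuous_onI)
  moreover have "(\<lambda>g. h ** g) \<in> space SU2_borel \<rightarrow> SU2"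
    using SU2_mult[OF assms] by auto
  ultimately show ?thesis
    using measurable_restrict_space2[of "\<lambda>g. h ** g" SU2_borel SU2 borel]
    by (simp flip: SU2_borel_def)
qed

section \<open>Wigner entries as measurable functions on SU(2)\<close>

text \<open>Measurability of a random polynomial is treated coefficient by coefficient: a
  coefficient of a product is a finite sum of products of coefficients. Products and powers of
  linear polynomials with measurable coefficients are thereby covered.\<close>

lemma borel_measurable_coeff_mult:
  fixes P Q :: "'a \<Rightarrow> complex poly"
  assumes "\<And>k. (\<lambda>x. coeff (P x) k) \<in> borel_measurable M"
    and "\<And>k. (\<lambda>x. coeff (Q x) k) \<in> borel_measurable M"
  shows "(\<lambda>x. coeff (P x * Q x) k) \<in> borel_measurable M"
  unfolding coeff_mult using assms by (intro borel_measurable_sum borel_measurable_times)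

lemma borel_measurable_coeff_power:
  fixes P :: "'a \<Rightarrow> complex poly"
  assumes "\<And>k. (\<lambda>x. coeff (P x) k) \<in> borel_measurable M"
  shows "(\<lambda>x. coeff (P x ^ n) k) \<in> borel_measurable M"
proof (induction n arbitrary: k)
  case (Suc n)
  then show ?case by (simp add: borel_measurable_coeff_mult assms)
qed simp

lemma borel_measurable_coeff_linear:
  fixes a b :: "'a \<Rightarrow> complex"
  assumes "a \<in> borel_measurable M" "b \<in> borel_measurable M"
  shows "(\<lambda>x. coeff [:a x, b x:] k) \<in> borel_measurable M"
  using assms by (auto simp: coeff_pCons split: nat.split)

text \<open>Setting \<open>z1 = 1\<close> in the defining relation exhibits the entries as polynomial coefficients.\<close>

lemma wigner_eq_coeff:
  assumes k: "k \<le> n" and q: "q \<le> n"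
  shows "wigner (real n / 2) g (real k - real n / 2) (real q - real n / 2) =
    complex_of_real (sqrt (real (n choose q))) / complex_of_real (sqrt (real (n choose k))) *
      coeff ([:cnj (g $ 2 $ 1), cnj (g $ 1 $ 1):] ^ q * [:g $ 1 $ 1, - (g $ 2 $ 1):] ^ (n - q)) k"
proof -
  let ?l = "real n / 2"
  let ?i = "\<lambda>k. real k - real n / 2"
  let ?c = "\<lambda>k. complex_of_real (sqrt (real (n choose k)))"
  let ?P = "[:cnj (g $ 2 $ 1), cnj (g $ 1 $ 1):] ^ q * [:g $ 1 $ 1, - (g $ 2 $ 1):] ^ (n - q)"
  have l: "?l \<in> half_nats" by (auto simp: half_nats_def)
  have qs: "?i q \<in> windex ?l" using q by (auto simp: windex_eq)
  \<comment> \<open>Two polynomials that agree at every complex \<open>z\<close> are equal, so the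
    coefficients of \<open>z ^ k\<close> can be compared.\<close>
  have "(\<Sum>j\<le>n. monom (?c j * wigner ?l g (?i j) (?i q)) j) = smult (?c q) ?P"
  proof (rule poly_eq_poly_eq_iff[THEN iffD1], rule ext)
    fix z
    have "(\<Sum>j\<le>n. ?c j * z ^ j * wigner ?l g (?i j) (?i q)) =
        (\<Sum>m\<in>windex ?l. wpsi ?l m z 1 * wigner ?l g m (?i q))"
      unfolding windex_eq by (subst sum.reindex[OF inj_windex]) (simp add: wpsi_eq)
    also have "\<dots> = wpsi ?l (?i q) (cnj (g $ 1 $ 1) * z + cnj (g $ 2 $ 1) * 1)
        (- (g $ 2 $ 1) * z + g $ 1 $ 1 * 1)"
      using wigner_rel_wigner[OF l, of g] qs unfolding wigner_rel_def by blast
    also have "\<dots> = poly (smult (?c q) ?P) z"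
      using q by (simp add: wpsi_eq algebra_simps)
    finally show "poly (\<Sum>j\<le>n. monom (?c j * wigner ?l g (?i j) (?i q)) j) z =
        poly (smult (?c q) ?P) z"
      by (simp add: poly_sum poly_monom mult_ac)
  qed
  from arg_cong[OF this, of "\<lambda>p. coeff p k"]
  have "?c k * wigner ?l g (?i k) (?i q) = ?c q * coeff ?P k"
    using k by (simp add: coeff_sum)
  moreover have "?c k \<noteq> 0" using k by simp
  ultimately show ?thesis by (simp add: field_simps)
qed

lemma borel_measurable_wigner:
  assumes "l \<in> half_nats" "m \<in> windex l" "s \<in> windex l"
  shows "(\<lambda>g. wigner l g m s) \<in> borel_measurable SU2_borel"
proof -
  obtain n where l: "l = real n / 2" using assms(1) by (auto simp: half_nats_def)
  obtain k where k: "k \<le> n" "m = real k - real n / 2" using assms(2) by (auto simp: l windex_eq)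
  obtain q where q: "q \<le> n" "s = real q - real n / 2" using assms(3) by (auto simp: l windex_eq)
  show ?thesis
    unfolding l k(2) q(2) wigner_eq_coeff[OF k(1) q(1)]
    by (intro borel_measurable_times borel_measurable_const borel_measurable_coeff_mult
        borel_measurable_coeff_power borel_measurable_coeff_linear borel_measurable_uminus
        measurable_SU2_nth measurable_SU2_cnj_nth)
qed

section \<open>The action of SU(2) on families of vectors\<close>

text \<open>One common \<open>g\<close> moves all members of the family at once, as strong
  invariance demands. The restriction to \<open>I\<close> keeps the result extensional, hence a
  point of \<open>family_space I l\<close>.\<close>

definition family_act ::
  "'i set \<Rightarrow> ('i \<Rightarrow> real) \<Rightarrow> complex ^ 2 ^ 2 \<Rightarrow> ('i \<Rightarrow> real \<Rightarrow> complex) \<Rightarrow> ('i \<Rightarrow> real \<Rightarrow> complex)" where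
  "family_act I l g v = (\<lambda>i\<in>I. wigner_act (l i) g (v i))"

lemma family_act_mult:
  assumes "\<And>i. i \<in> I \<Longrightarrow> l i \<in> half_nats" "g \<in> SU2"
  shows "family_act I l (g ** h) v = family_act I l g (family_act I l h v)"
  using assms by (auto simp: family_act_def wigner_act_mult)

text \<open>Joint measurability in \<open>g\<close> and \<open>v\<close> is what Fubini and the law
  of the randomly rotated family require. It is tested coordinatewise, so \<open>I\<close> may be
  infinite: each coordinate is a finite sum of Wigner entries times coordinates of
  \<open>v\<close>.\<close>

lemma measurable_family_act:
  assumes l: "\<And>i. i \<in> I \<Longrightarrow> l i \<in> half_nats"
  shows "(\<lambda>(g, v). family_act I l g v) \<in>
    measurable (SU2_borel \<Otimes>\<^sub>M family_space I l) (family_space I l)"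
proof -
  have v: "(\<lambda>x. snd x i s) \<in> borel_measurable (SU2_borel \<Otimes>\<^sub>M family_space I l)"
    if i: "i \<in> I" and s: "s \<in> windex (l i)" for i s
  proof -
    have "(\<lambda>x. snd x i) \<in> measurable (SU2_borel \<Otimes>\<^sub>M family_space I l) (wspace (l i))"
      unfolding family_space_def
      by (rule measurable_compose[OF measurable_snd measurable_component_singleton[OF i]])
    then show ?thesis
      unfolding wspace_def by (rule measurable_compose[OF _ measurable_component_singleton[OF s]])
  qed
  have w: "(\<lambda>x. wigner (l i) (fst x) m s) \<in> borel_measurable (SU2_borel \<Otimes>\<^sub>M family_space I l)"
    if "i \<in> I" "m \<in> windex (l i)" "s \<in> windex (l i)" for i m s
    by (rule measurable_compose[OF measurable_fst borel_measurable_wigner]) (use that l in auto)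
  have "(\<lambda>x. \<lambda>i\<in>I. \<lambda>m\<in>windex (l i). \<Sum>s\<in>windex (l i). wigner (l i) (fst x) m s * snd x i s) \<in>
    measurable (SU2_borel \<Otimes>\<^sub>M family_space I l) (PiM I (\<lambda>i. PiM (windex (l i)) (\<lambda>_. borel)))"
    by (intro measurable_restrict borel_measurable_sum borel_measurable_times v w)
  then show ?thesis
    by (simp add: family_act_def wigner_act_def family_space_def wspace_def split_beta' cong: restrict_cong)
qed

section \<open>Laws\<close>

text \<open>Independence is the product formula on measurable rectangles, and for sigma-finite
  factors the values on rectangles determine the product measure.\<close>

lemma distr_independent_rv:
  assumes N: "prob_space N" and ind: "independent_rv N S X T Y"
  shows "distr N (S \<Otimes>\<^sub>M T) (\<lambda>\<omega>. (X \<omega>, Y \<omega>)) = distr N S X \<Otimes>\<^sub>M distr N T Y"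
proof -
  interpret N: prob_space N by fact
  have X: "X \<in> measurable N S" and Y: "Y \<in> measurable N T"
    and set: "N.indep_set {X -` A \<inter> space N |A. A \<in> sets S} {Y -` B \<inter> space N |B. B \<in> sets T}"
    using ind by (auto simp: independent_rv_def)
  interpret X: prob_space "distr N S X" by (rule N.prob_space_distr[OF X])
  interpret Y: prob_space "distr N T Y" by (rule N.prob_space_distr[OF Y])
  show ?thesis
  proof (rule pair_measure_eqI[symmetric])
    show "sets (distr N S X \<Otimes>\<^sub>M distr N T Y) = sets (distr N (S \<Otimes>\<^sub>M T) (\<lambda>\<omega>. (X \<omega>, Y \<omega>)))"
      by (simp cong: sets_pair_measure_cong)
    fix A B assume "A \<in> sets (distr N S X)" "B \<in> sets (distr N T Y)"
    then have A: "A \<in> sets S" and B: "B \<in> sets T" by auto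
    have "N.prob ((X -` A \<inter> space N) \<inter> (Y -` B \<inter> space N)) =
        N.prob (X -` A \<inter> space N) * N.prob (Y -` B \<inter> space N)"
      using A B by (intro N.indep_setD[OF set]) auto
    moreover have "(\<lambda>\<omega>. (X \<omega>, Y \<omega>)) -` (A \<times> B) \<inter> space N =
        (X -` A \<inter> space N) \<inter> (Y -` B \<inter> space N)"
      by auto
    ultimately show "emeasure (distr N S X) A * emeasure (distr N T Y) B =
        emeasure (distr N (S \<Otimes>\<^sub>M T) (\<lambda>\<omega>. (X \<omega>, Y \<omega>))) (A \<times> B)"
      using A B X Y by (simp add: emeasure_distr N.emeasure_eq_measure ennreal_mult)
  qed (rule X.sigma_finite_measure_axioms Y.sigma_finite_measure_axioms)+
qed

text \<open>Fubini for an action that preserves the second factor.\<close>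

lemma distr_pair_invariant:
  assumes P: "prob_space P" and Q: "prob_space Q"
    and f: "(\<lambda>(x, y). f x y) \<in> measurable (P \<Otimes>\<^sub>M Q) Q"
    and inv: "\<And>x. x \<in> space P \<Longrightarrow> distr Q Q (f x) = Q"
  shows "distr (P \<Otimes>\<^sub>M Q) Q (\<lambda>(x, y). f x y) = Q"
proof (rule measure_eqI)
  interpret P: prob_space P by fact
  interpret Q: prob_space Q by fact
  fix A assume "A \<in> sets (distr (P \<Otimes>\<^sub>M Q) Q (\<lambda>(x, y). f x y))"
  then have A: "A \<in> sets Q" by simp
  let ?B = "(\<lambda>(x, y). f x y) -` A \<inter> space (P \<Otimes>\<^sub>M Q)"
  have "emeasure (distr (P \<Otimes>\<^sub>M Q) Q (\<lambda>(x, y). f x y)) A = emeasure (P \<Otimes>\<^sub>M Q) ?B"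
    using f A by (simp add: emeasure_distr)
  also have "\<dots> = (\<integral>\<^sup>+x. emeasure Q (Pair x -` ?B) \<partial>P)"
    using measurable_sets[OF f A] by (rule Q.emeasure_pair_measure_alt)
  also have "\<dots> = (\<integral>\<^sup>+x. emeasure Q A \<partial>P)"
  proof (rule nn_integral_cong)
    fix x assume x: "x \<in> space P"
    then have "f x \<in> measurable Q Q" using measurable_Pair2[OF f x] by simp
    \<comment> \<open>The section at \<open>x\<close> of the preimage is the preimage under
      \<open>f x\<close>, whose mass is that of \<open>A\<close> by invariance.\<close>
    moreover have "Pair x -` ?B = f x -` A \<inter> space Q"
      using x by (auto simp: space_pair_measure)
    ultimately have "emeasure Q (Pair x -` ?B) = emeasure (distr Q Q (f x)) A"
      using A by (simp add: emeasure_distr)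
    then show "emeasure Q (Pair x -` ?B) = emeasure Q A" by (simp only: inv[OF x])
  qed
  also have "\<dots> = emeasure Q A" by (simp add: P.emeasure_space_1)
  finally show "emeasure (distr (P \<Otimes>\<^sub>M Q) Q (\<lambda>(x, y). f x y)) A = emeasure Q A" .
qed simp

section \<open>Strong invariance as a fixed point of Haar averaging\<close>

theorem theorem9:
  fixes M :: "'a measure" and N :: "'b measure" and I :: "'i set"
    and l :: "'i \<Rightarrow> real" and V :: "'i \<Rightarrow> 'a \<Rightarrow> real \<Rightarrow> complex"
    and p :: "'b \<Rightarrow> 'a" and \<gamma> :: "'b \<Rightarrow> complex ^ 2 ^ 2"
  assumes "prob_space M"
    and "\<And>i. i \<in> I \<Longrightarrow> l i \<in> half_nats"
    and "\<And>i. i \<in> I \<Longrightarrow> V i \<in> measurable M (wspace (l i))"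
    \<comment> \<open>\<open>N\<close> extends \<open>M\<close>, to make room for \<open>\<gamma>\<close>; \<open>N = M\<close> and \<open>p = id\<close> is allowed\<close>
    and "prob_space N" and "p \<in> measurable N M" and "distr N M p = M"
    and "\<gamma> \<in> measurable N SU2_borel" and "haar_SU2 (distr N SU2_borel \<gamma>)"
    and "independent_rv N SU2_borel \<gamma> (family_space I l) (\<lambda>\<omega>. \<lambda>i\<in>I. V i (p \<omega>))"
  shows "strongly_D_invariant M I l V \<longleftrightarrow>
    joint_law M I l V = joint_law N I l (\<lambda>i \<omega>. wigner_act (l i) (\<gamma> \<omega>) (V i (p \<omega>)))"
proof -
  let ?F = "family_space I l"
  define X where "X = (\<lambda>\<omega>. \<lambda>i\<in>I. V i \<omega>)"
  define \<mu> where "\<mu> = joint_law M I l V"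
  define \<eta> where "\<eta> = distr N SU2_borel \<gamma>"
  define act where "act = (\<lambda>(g, v). family_act I l g v)"
  note l = assms(2)
  have X: "X \<in> measurable M ?F"
    unfolding X_def family_space_def using assms(3) by (intro measurable_restrict)
  have \<mu>_eq: "\<mu> = distr M ?F X" by (simp add: \<mu>_def joint_law_def X_def)
  have [measurable_cong]: "sets \<mu> = sets ?F" "sets \<eta> = sets SU2_borel"
    by (simp_all add: \<mu>_eq \<eta>_def)
  have prob: "prob_space \<mu>" "prob_space \<eta>"
    unfolding \<mu>_eq \<eta>_def using assms X by (auto intro!: prob_space.prob_space_distr)
  have act: "act \<in> measurable (SU2_borel \<Otimes>\<^sub>M ?F) ?F"
    unfolding act_def using l by (rule measurable_family_act)
  then have act': "act \<in> measurable (\<eta> \<Otimes>\<^sub>M \<mu>) ?F" by measurable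
  \<comment> \<open>For fixed \<open>g\<close> this is a section of the jointly measurable
    \<open>act\<close>.\<close>
  have act_g: "family_act I l g \<in> measurable ?F ?F" if "g \<in> SU2" for g
    using measurable_Pair2[OF act, of g] that by (simp add: act_def)
  have law_g: "joint_law M I l (\<lambda>i \<omega>. wigner_act (l i) g (V i \<omega>)) = distr \<mu> ?F (family_act I l g)"
    if "g \<in> SU2" for g
  proof -
    have "(\<lambda>\<omega>. \<lambda>i\<in>I. wigner_act (l i) g (V i \<omega>)) = family_act I l g \<circ> X"
      by (simp add: family_act_def X_def comp_def cong: restrict_cong)
    then show ?thesis
      by (simp add: joint_law_def \<mu>_eq distr_distr[OF act_g[OF that] X])
  qed
  have invariant: "strongly_D_invariant M I l V \<longleftrightarrow> (\<forall>g\<in>SU2. \<mu> = distr \<mu> ?F (family_act I l g))"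
    unfolding strongly_D_invariant_def \<mu>_def[symmetric] using law_g by auto
  \<comment> \<open>Since \<open>p\<close> carries \<open>N\<close> to \<open>M\<close>, the family
    has the same law on the extended space.\<close>
  have "distr N ?F (\<lambda>\<omega>. X (p \<omega>)) = \<mu>"
    using distr_distr[OF X assms(5)] by (simp add: assms(6) \<mu>_eq comp_def)
  moreover have "distr N (SU2_borel \<Otimes>\<^sub>M ?F) (\<lambda>\<omega>. (\<gamma> \<omega>, X (p \<omega>))) =
      distr N SU2_borel \<gamma> \<Otimes>\<^sub>M distr N ?F (\<lambda>\<omega>. X (p \<omega>))"
    using assms(4,9) by (intro distr_independent_rv) (auto simp: X_def)
  ultimately have pair: "distr N (SU2_borel \<Otimes>\<^sub>M ?F) (\<lambda>\<omega>. (\<gamma> \<omega>, X (p \<omega>))) = \<eta> \<Otimes>\<^sub>M \<mu>"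
    by (simp add: \<eta>_def)
  have law_\<gamma>: "joint_law N I l (\<lambda>i \<omega>. wigner_act (l i) (\<gamma> \<omega>) (V i (p \<omega>))) = distr (\<eta> \<Otimes>\<^sub>M \<mu>) ?F act"
  proof -
    have "(\<lambda>\<omega>. \<lambda>i\<in>I. wigner_act (l i) (\<gamma> \<omega>) (V i (p \<omega>))) = act \<circ> (\<lambda>\<omega>. (\<gamma> \<omega>, X (p \<omega>)))"
      by (simp add: act_def family_act_def X_def comp_def cong: restrict_cong)
    moreover have "(\<lambda>\<omega>. (\<gamma> \<omega>, X (p \<omega>))) \<in> measurable N (SU2_borel \<Otimes>\<^sub>M ?F)"
      using assms(5,7) X by measurable
    ultimately show ?thesis
      by (simp add: joint_law_def distr_distr[OF act] flip: pair)
  qed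
  have "\<mu> = distr (\<eta> \<Otimes>\<^sub>M \<mu>) ?F act" if inv: "\<And>g. g \<in> SU2 \<Longrightarrow> \<mu> = distr \<mu> ?F (family_act I l g)"
  proof -
    \<comment> \<open>The target is \<mu> instead of \<open>?F\<close> to match
      \<open>distr_pair_invariant\<close>; both have the same measurable sets, so the image measure
      is unchanged.\<close>
    have "distr (\<eta> \<Otimes>\<^sub>M \<mu>) \<mu> (\<lambda>(g, v). family_act I l g v) = \<mu>"
    proof (rule distr_pair_invariant[OF prob(2,1)])
      show "(\<lambda>(g, v). family_act I l g v) \<in> measurable (\<eta> \<Otimes>\<^sub>M \<mu>) \<mu>"
        using act' unfolding act_def by measurable
      fix g assume "g \<in> space \<eta>"
      then have "g \<in> SU2" by (simp add: \<eta>_def)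
      then have "distr \<mu> ?F (family_act I l g) = \<mu>" using inv by simp
      then show "distr \<mu> \<mu> (family_act I l g) = \<mu>"
        by (simp cong: distr_cong add: \<open>sets \<mu> = sets ?F\<close>)
    qed
    then show ?thesis
      by (simp add: act_def \<open>sets \<mu> = sets ?F\<close> cong: distr_cong)
  qed
  moreover have "\<mu> = distr \<mu> ?F (family_act I l h)"
    if eq: "\<mu> = distr (\<eta> \<Otimes>\<^sub>M \<mu>) ?F act" and h: "h \<in> SU2" for h
  proof -
    have mult: "(\<lambda>g. h ** g) \<in> measurable \<eta> SU2_borel"
      using measurable_SU2_mult[OF h] by measurable
    have haar: "distr \<eta> SU2_borel (\<lambda>g. h ** g) = \<eta>"
      using assms(8) h by (simp add: haar_SU2_def \<eta>_def)
    have id: "distr \<mu> ?F (\<lambda>v. v) = \<mu>"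
      by (simp add: distr_id2 \<open>sets \<mu> = sets ?F\<close>)
    \<comment> \<open>Left invariance of \<eta> in the first factor and the identity in the second
      leave the product measure fixed.\<close>
    have shift: "distr (\<eta> \<Otimes>\<^sub>M \<mu>) (SU2_borel \<Otimes>\<^sub>M ?F) (\<lambda>(g, v). (h ** g, v)) = \<eta> \<Otimes>\<^sub>M \<mu>"
      using pair_measure_distr[OF mult, of "\<lambda>v. v" \<mu> ?F] prob(1)
      by (simp add: haar id prob_space_imp_sigma_finite)
    have shift_meas: "(\<lambda>(g, v). (h ** g, v)) \<in> measurable (\<eta> \<Otimes>\<^sub>M \<mu>) (SU2_borel \<Otimes>\<^sub>M ?F)"
      using mult by measurable
    \<comment> \<open>The assumed equality is used twice: first to write \<mu> as a Haar average,
      and after \<open>h\<close> has been absorbed into the Haar element, to return to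
      \<mu>.\<close>
    have "distr \<mu> ?F (family_act I l h) = distr (distr (\<eta> \<Otimes>\<^sub>M \<mu>) ?F act) ?F (family_act I l h)"
      by (simp flip: eq)
    also have "\<dots> = distr (\<eta> \<Otimes>\<^sub>M \<mu>) ?F (family_act I l h \<circ> act)"
      by (rule distr_distr[OF act_g[OF h] act'])
    also have "family_act I l h \<circ> act = act \<circ> (\<lambda>(g, v). (h ** g, v))"
      using l h by (auto simp: act_def family_act_mult)
    also have "distr (\<eta> \<Otimes>\<^sub>M \<mu>) ?F \<dots> =
        distr (distr (\<eta> \<Otimes>\<^sub>M \<mu>) (SU2_borel \<Otimes>\<^sub>M ?F) (\<lambda>(g, v). (h ** g, v))) ?F act"
      by (rule distr_distr[OF act shift_meas, symmetric])
    also have "\<dots> = \<mu>" by (simp only: shift eq[symmetric])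
    finally show ?thesis ..
  qed
  ultimately show ?thesis
    unfolding invariant law_\<gamma> \<mu>_def[symmetric] by blast
qed

end
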